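(* Suppose $n\geq2$ and $k\geq5$. Then $A_k(n)$ is an antisymmetric Eulerian subgraph of $B_{k}(n-1)$ with $k^{n-1}\left\lfloor\frac{k-1}{2}\right\rfloor$ edges.
   Context: For $r\geq 1$, the de Bruijn digraph $B_k(r)$ has vertex set $\mathbb{Z}_k^r$, and $(\mathbf{x},\mathbf{y})$ is a (directed) edge iff $y_i=x_{i+1}$ for $0\le i<r-1$; this edge is identified with the $(r+1)$-tuple $(x_0,\ldots,x_{r-1},y_{r-1})$ (distinct tuples give distinct edges). For a tuple $\mathbf{u}=(u_0,\ldots,u_{r-1})$ its reverse is $\mathbf{u}^R=(u_{r-1},\ldots,u_0)$. $A_k(n)$ is the subgraph of $B_k(n-1)$, on the vertices of $B_k(n-1)$, with edges corresponding to the $n$-tuples $(a_0,a_1,\ldots,a_{n-1})$, $a_i\in\mathbb{Z}_k$, for which $a_{n-1}-a_0\in\{1,2,\ldots,\lfloor(k-1)/2\rfloor\}$ (as residues modulo $k$). A subgraph $T$ of $B_k(r)$ is antisymmetric if whenever $(\mathbf{x},\mathbf{y})$ is an edge of $T$, $(\mathbf{y}^R,\mathbf{x}^R)$ is not an edge of $T$ (equivalently, if the tuple $\mathbf{a}$ labels an edge of $T$, then $\mathbf{a}^R$ does not). An Eulerian digraph is a connected digraph in which every vertex has in-degree equal to out-degree. *)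

theory Defs
  imports "Graph_Theory.Graph_Theory"
begin

text \<open>
  Residues modulo \<open>k\<close> are represented by the integers in \<open>{0..<k}\<close>, and a tuple
  \<open>(u\<^sub>0, \<dots>, u\<^sub>r\<^sub>-\<^sub>1)\<close> by a list, so that its reverse is \<^const>\<open>rev\<close>.
\<close>

definition tuples :: "nat \<Rightarrow> nat \<Rightarrow> int list set" where
  "tuples k r = {u. length u = r \<and> set u \<subseteq> {0..<int k}}"

definition de_bruijn :: "nat \<Rightarrow> nat \<Rightarrow> (int list, int list \<times> int list) pre_digraph" where
  "de_bruijn k r =
     \<lparr> verts = tuples k r,
       arcs = {(x, y). x \<in> tuples k r \<and> y \<in> tuples k r \<and> (\<forall>i < r - 1. y ! i = x ! (i + 1))},
       tail = fst, head = snd \<rparr>"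

text \<open>
  The \<open>(r + 1)\<close>-tuple with which an edge of \<open>de_bruijn k r\<close> is identified, for \<open>r \<ge> 1\<close>.
\<close>

definition edge_tuple :: "int list \<times> int list \<Rightarrow> int list" where
  "edge_tuple e = fst e @ [last (snd e)]"

definition A_graph :: "nat \<Rightarrow> nat \<Rightarrow> (int list, int list \<times> int list) pre_digraph" where
  "A_graph k n =
     \<lparr> verts = verts (de_bruijn k (n - 1)),
       arcs = {e \<in> arcs (de_bruijn k (n - 1)).
                 (edge_tuple e ! (n - 1) - edge_tuple e ! 0) mod int k \<in> {1..(int k - 1) div 2}},
       tail = fst, head = snd \<rparr>"

definition antisymmetric :: "(int list, int list \<times> int list) pre_digraph \<Rightarrow> bool" where
  "antisymmetric T \<longleftrightarrow> (\<forall>x y. (x, y) \<in> arcs T \<longrightarrow> (rev y, rev x) \<notin> arcs T)"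

text \<open>
  Finiteness makes the degrees, which are cardinalities, meaningful; \<^const>\<open>connected\<close> is
  connectedness of the underlying undirected graph.
\<close>

definition eulerian_digraph :: "('a, 'b) pre_digraph \<Rightarrow> bool" where
  "eulerian_digraph G \<longleftrightarrow>
     fin_digraph G \<and> connected G \<and> (\<forall>v \<in> verts G. in_degree G v = out_degree G v)"

end

theory Submission
  imports Defs
begin

text \<open>
  Every edge of the de Bruijn digraph has the form \<open>a # w \<rightarrow> w @ [b]\<close>, and it is kept when the
  jump \<open>b - a\<close> lies in the set \<open>D = {1, \<dots>, m}\<close> of residues, \<open>m = \<lfloor>(k - 1) / 2\<rfloor>\<close>.  For fixed
  \<open>a\<close> each jump in \<open>D\<close> determines \<open>b\<close>, and for fixed \<open>b\<close> it determines \<open>a\<close>; hence all in- and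
  out-degrees equal \<open>m\<close>, and the number of edges is \<open>m\<close> times the number of vertices.  Reversing a
  tuple negates its jump, and \<open>D\<close> is disjoint from \<open>-D\<close> because \<open>2 * m < k\<close>.

  Connectedness uses \<open>k \<ge> 5\<close> in the form \<open>{1, 2} \<subseteq> D\<close>.  The vertex \<open>(c - 1) # u\<close> is then adjacent
  to both \<open>u @ [c]\<close> and \<open>u @ [c + 1]\<close>, so changing the last entry of a vertex does not change its
  component.  Therefore every edge of the whole de Bruijn digraph joins vertices in the same
  component, and shifting in zeros one at a time leads from any vertex to the zero tuple.
\<close>

abbreviation jumps :: "nat \<Rightarrow> int set" where
  "jumps k \<equiv> {1..(int k - 1) div 2}"

section \<open>Residues with a prescribed difference\<close>

lemma card_residues_above:
  fixes a k :: int
  assumes "k > 0" "D \<subseteq> {0..<k}"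
  shows "card {b \<in> {0..<k}. (b - a) mod k \<in> D} = card D"
proof (rule bij_betw_same_card)
  show "bij_betw (\<lambda>b. (b - a) mod k) {b \<in> {0..<k}. (b - a) mod k \<in> D} D"
    by (rule bij_betw_byWitness[where f' = "\<lambda>d. (a + d) mod k"])
       (use assms in \<open>auto simp: mod_simps subset_iff\<close>)
qed

lemma card_residues_below:
  fixes b k :: int
  assumes "k > 0" "D \<subseteq> {0..<k}"
  shows "card {a \<in> {0..<k}. (b - a) mod k \<in> D} = card D"
proof (rule bij_betw_same_card)
  show "bij_betw (\<lambda>a. (b - a) mod k) {a \<in> {0..<k}. (b - a) mod k \<in> D} D"
    by (rule bij_betw_byWitness[where f' = "\<lambda>d. (b - d) mod k"])
       (use assms in \<open>auto simp: mod_simps subset_iff\<close>)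
qed

lemma jumps_subset_residues: "jumps k \<subseteq> {0..<int k}"
  by auto

lemma card_jumps: "card (jumps k) = (k - 1) div 2"
  by simp

lemma uminus_notin_jumps:
  assumes "d mod int k \<in> jumps k"
  shows "(- d) mod int k \<notin> jumps k"
  using assms by (auto simp: zmod_zminus1_eq_if)

section \<open>Vertices and edges\<close>

lemma finite_tuples: "finite (tuples k r)"
  and card_tuples: "card (tuples k r) = k ^ r"
  using finite_lists_length_eq[of "{0..<int k}" r] card_lists_length_eq[of "{0..<int k}" r]
  by (simp_all add: tuples_def conj_commute)

lemma Cons_in_tuples_iff: "a # w \<in> tuples k (Suc r) \<longleftrightarrow> a \<in> {0..<int k} \<and> w \<in> tuples k r"
  by (auto simp: tuples_def)

lemma snoc_in_tuples_iff: "w @ [b] \<in> tuples k (Suc r) \<longleftrightarrow> b \<in> {0..<int k} \<and> w \<in> tuples k r"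
  by (auto simp: tuples_def)

lemma tuples_Suc_cases:
  assumes "x \<in> tuples k (Suc r)"
  obtains a w where "x = a # w" "a \<in> {0..<int k}" "w \<in> tuples k r"
  using assms by (cases x) (auto simp: tuples_def)

lemma tuples_Suc_snoc_cases:
  assumes "x \<in> tuples k (Suc r)"
  obtains w b where "x = w @ [b]" "b \<in> {0..<int k}" "w \<in> tuples k r"
  using assms by (cases x rule: rev_cases) (auto simp: tuples_def)

lemma A_graph_simps [simp]:
  "verts (A_graph k n) = tuples k (n - 1)"
  "tail (A_graph k n) = fst"
  "head (A_graph k n) = snd"
  by (simp_all add: A_graph_def de_bruijn_def)

text \<open>
  The overlap condition on a pair of vertices says that they share a common middle part \<open>w\<close>;
  all later arguments use this shape of an edge instead of indices.
\<close>

lemma A_graph_arc_Cons_snoc_iff: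
  "(a # w, v @ [b]) \<in> arcs (A_graph k (Suc (Suc r))) \<longleftrightarrow>
     v = w \<and> w \<in> tuples k r \<and> a \<in> {0..<int k} \<and> b \<in> {0..<int k} \<and> (b - a) mod int k \<in> jumps k"
  (is "?L \<longleftrightarrow> ?R")
proof -
  have overlap: "(\<forall>i<r. (v @ [b]) ! i = (a # w) ! (i + 1)) \<longleftrightarrow> v = w"
    if "w \<in> tuples k r" "v \<in> tuples k r"
    using that by (auto simp: tuples_def nth_append list_eq_iff_nth_eq)
  have ends: "edge_tuple (a # w, v @ [b]) ! Suc r = b" "edge_tuple (a # w, v @ [b]) ! 0 = a"
    if "w \<in> tuples k r"
    using that by (auto simp: edge_tuple_def tuples_def nth_append)
  show ?thesis
    using overlap ends
    by (auto simp: A_graph_def de_bruijn_def Cons_in_tuples_iff snoc_in_tuples_iff)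
qed

lemma A_graph_arc_cases:
  assumes "(x, y) \<in> arcs (A_graph k (Suc (Suc r)))"
  obtains a w b where "x = a # w" "y = w @ [b]" "w \<in> tuples k r" "a \<in> {0..<int k}"
    "b \<in> {0..<int k}" "(b - a) mod int k \<in> jumps k"
proof -
  have "x \<in> tuples k (Suc r)" "y \<in> tuples k (Suc r)"
    using assms by (auto simp: A_graph_def de_bruijn_def)
  then obtain a w v b where "x = a # w" "y = v @ [b]"
    by (metis tuples_Suc_cases tuples_Suc_snoc_cases)
  with assms that show ?thesis
    by (auto simp: A_graph_arc_Cons_snoc_iff)
qed

lemma subgraph_A_graph: "subgraph (A_graph k n) (de_bruijn k (n - 1))"
  by (auto simp: subgraph_def compatible_def wf_digraph_def A_graph_def de_bruijn_def)

lemma fin_digraph_A_graph: "fin_digraph (A_graph k n)"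
proof -
  have wf: "wf_digraph (A_graph k n)"
    using subgraph_A_graph by (auto simp: subgraph_def)
  have "arcs (A_graph k n) \<subseteq> tuples k (n - 1) \<times> tuples k (n - 1)"
    by (auto simp: A_graph_def de_bruijn_def)
  then have "finite (arcs (A_graph k n))"
    by (rule finite_subset) (simp add: finite_tuples)
  with wf show ?thesis
    by (intro wf_digraph.fin_digraphI) (simp_all add: finite_tuples)
qed

text \<open>The reverse of the edge tuple \<open>a # w @ [b]\<close> has jump \<open>a - b\<close>.\<close>

lemma antisymmetric_A_graph: "antisymmetric (A_graph k (Suc (Suc r)))"
  unfolding antisymmetric_def
proof (intro allI impI notI)
  fix x y
  assume "(x, y) \<in> arcs (A_graph k (Suc (Suc r)))"
    and rev: "(rev y, rev x) \<in> arcs (A_graph k (Suc (Suc r)))"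
  then obtain a w b where "x = a # w" "y = w @ [b]" "(b - a) mod int k \<in> jumps k"
    by (metis A_graph_arc_cases)
  with rev uminus_notin_jumps[of "b - a" k] show False
    by (simp add: A_graph_arc_Cons_snoc_iff)
qed

section \<open>Degrees and the number of edges\<close>

lemma out_degree_A_graph:
  assumes "k > 0" "x \<in> tuples k (Suc r)"
  shows "out_degree (A_graph k (Suc (Suc r))) x = (k - 1) div 2"
proof -
  obtain a w where x: "x = a # w" "a \<in> {0..<int k}" "w \<in> tuples k r"
    using assms(2) by (rule tuples_Suc_cases)
  let ?B = "{b \<in> {0..<int k}. (b - a) mod int k \<in> jumps k}"
  have "out_arcs (A_graph k (Suc (Suc r))) x = (\<lambda>b. (a # w, w @ [b])) ` ?B"
    using x by (auto simp: A_graph_arc_Cons_snoc_iff elim!: A_graph_arc_cases)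
  moreover have "inj_on (\<lambda>b. (a # w, w @ [b])) ?B"
    by (auto simp: inj_on_def)
  ultimately show ?thesis
    using card_residues_above[OF _ jumps_subset_residues, of k a] assms(1)
    by (simp only: out_degree_def card_image card_jumps of_nat_0_less_iff)
qed

lemma in_degree_A_graph:
  assumes "k > 0" "y \<in> tuples k (Suc r)"
  shows "in_degree (A_graph k (Suc (Suc r))) y = (k - 1) div 2"
proof -
  obtain w b where y: "y = w @ [b]" "b \<in> {0..<int k}" "w \<in> tuples k r"
    using assms(2) by (rule tuples_Suc_snoc_cases)
  let ?B = "{a \<in> {0..<int k}. (b - a) mod int k \<in> jumps k}"
  have "in_arcs (A_graph k (Suc (Suc r))) y = (\<lambda>a. (a # w, w @ [b])) ` ?B"
    using y by (auto simp: A_graph_arc_Cons_snoc_iff elim!: A_graph_arc_cases)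
  moreover have "inj_on (\<lambda>a. (a # w, w @ [b])) ?B"
    by (auto simp: inj_on_def)
  ultimately show ?thesis
    using card_residues_below[OF _ jumps_subset_residues, of k b] assms(1)
    by (simp only: in_degree_def card_image card_jumps of_nat_0_less_iff)
qed

lemma (in fin_digraph) card_arcs_eq_sum_out_degree:
  "card (arcs G) = (\<Sum>v \<in> verts G. out_degree G v)"
proof -
  have "arcs G = (\<Union>v \<in> verts G. out_arcs G v)"
    by auto
  also have "card \<dots> = (\<Sum>v \<in> verts G. card (out_arcs G v))"
    by (rule card_UN_disjoint) auto
  finally show ?thesis
    by (simp add: out_degree_def)
qed

lemma card_arcs_A_graph:
  assumes "k > 0"
  shows "card (arcs (A_graph k (Suc (Suc r)))) = k ^ Suc r * ((k - 1) div 2)"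
  using fin_digraph.card_arcs_eq_sum_out_degree[OF fin_digraph_A_graph[of k "Suc (Suc r)"]]
    out_degree_A_graph[OF assms]
  by (simp add: card_tuples)

section \<open>Connectedness\<close>

abbreviation linked :: "nat \<Rightarrow> nat \<Rightarrow> int list \<Rightarrow> int list \<Rightarrow> bool" where
  "linked k r x y \<equiv> x \<rightarrow>\<^sup>*\<^bsub>with_proj (mk_symmetric (A_graph k (Suc (Suc r))))\<^esub> y"

lemma linked_refl: "x \<in> tuples k (Suc r) \<Longrightarrow> linked k r x x"
  by (simp add: reachable_def)

lemma linked_trans: "linked k r x y \<Longrightarrow> linked k r y z \<Longrightarrow> linked k r x z"
  unfolding reachable_def by (rule rtrancl_on_trans)

lemma linked_sym: "linked k r x y \<Longrightarrow> linked k r y x"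
  by (rule symmetric_reachable[OF symmetric_mk_symmetric])

lemma linked_arc:
  assumes "(x, y) \<in> arcs (A_graph k (Suc (Suc r)))"
  shows "linked k r x y"
proof -
  interpret fin_digraph "A_graph k (Suc (Suc r))"
    by (rule fin_digraph_A_graph)
  have "x \<rightarrow>\<^bsub>A_graph k (Suc (Suc r))\<^esub> y"
    using assms by (intro dominatesI[of "(x, y)"]) (simp_all add: arc_to_ends_def)
  then show ?thesis
    by (intro reachable_mk_symmetricI reachable_adjI)
qed

lemma linked_snoc_successor:
  assumes "k \<ge> 5" "u \<in> tuples k r" "0 \<le> c" "c + 1 < int k"
  shows "linked k r (u @ [c]) (u @ [c + 1])"
proof -
  \<comment> \<open>The common in-neighbour, with jumps 1 and 2; it wraps around when \<open>c = 0\<close>.\<close>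
  let ?x = "((c - 1) mod int k) # u"
  have "(c - (c - 1) mod int k) mod int k = 1" "(c + 1 - (c - 1) mod int k) mod int k = 2"
    using assms(1) by (simp_all add: mod_simps)
  then have "(?x, u @ [c]) \<in> arcs (A_graph k (Suc (Suc r)))"
    "(?x, u @ [c + 1]) \<in> arcs (A_graph k (Suc (Suc r)))"
    using assms by (simp_all add: A_graph_arc_Cons_snoc_iff)
  then show ?thesis
    by (meson linked_arc linked_sym linked_trans)
qed

lemma linked_snoc_snoc:
  assumes "k \<ge> 5" "u \<in> tuples k r" "b \<in> {0..<int k}" "c \<in> {0..<int k}"
  shows "linked k r (u @ [b]) (u @ [c])"
proof -
  have from_0: "linked k r (u @ [0]) (u @ [int j])" if "j < k" for j
    using that
  proof (induction j)
    case 0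
    then show ?case
      using assms by (simp add: linked_refl snoc_in_tuples_iff)
  next
    case (Suc j)
    have "linked k r (u @ [int j]) (u @ [int j + 1])"
      using Suc.prems assms by (intro linked_snoc_successor) auto
    with Suc show ?case
      by (auto simp: add.commute intro: linked_trans)
  qed
  have "linked k r (u @ [0]) (u @ [b])" "linked k r (u @ [0]) (u @ [c])"
    using from_0[of "nat b"] from_0[of "nat c"] assms by auto
  then show ?thesis
    by (meson linked_sym linked_trans)
qed

text \<open>
  The jump from \<open>a\<close> to \<open>b\<close> is arbitrary here: follow the edge with jump 1 and then correct the last
  entry.
\<close>

lemma linked_shift:
  assumes "k \<ge> 5" "w \<in> tuples k r" "a \<in> {0..<int k}" "b \<in> {0..<int k}"
  shows "linked k r (a # w) (w @ [b])"
proof -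
  let ?c = "(a + 1) mod int k"
  have "(?c - a) mod int k = 1"
    using assms(1) by (simp add: mod_simps)
  then have "linked k r (a # w) (w @ [?c])"
    using assms by (intro linked_arc) (simp add: A_graph_arc_Cons_snoc_iff)
  moreover have "linked k r (w @ [?c]) (w @ [b])"
    using assms by (intro linked_snoc_snoc) auto
  ultimately show ?thesis
    by (rule linked_trans)
qed

lemma linked_zero_tuple:
  assumes "k \<ge> 5" "x \<in> tuples k (Suc r)"
  shows "linked k r x (replicate (Suc r) 0)"
proof -
  have "linked k r x (drop i x @ replicate i 0)" if "i \<le> Suc r" for i
    using that
  proof (induction i)
    case 0
    then show ?case
      using assms by (simp add: linked_refl)
  next
    case (Suc i)
    have i: "i < length x"
      using Suc.prems assms(2) by (simp add: tuples_def)
    let ?w = "drop (Suc i) x @ replicate i 0"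
    have "?w \<in> tuples k r"
      using assms i by (auto simp: tuples_def dest: in_set_dropD)
    moreover have "x ! i \<in> {0..<int k}"
      using assms(2) nth_mem[OF i] unfolding tuples_def by blast
    ultimately have "linked k r (x ! i # ?w) (?w @ [0])"
      using assms by (intro linked_shift) auto
    then have "linked k r (drop i x @ replicate i 0) (drop (Suc i) x @ replicate (Suc i) 0)"
      using i by (simp add: Cons_nth_drop_Suc[symmetric] replicate_append_same)
    with Suc show ?case
      by (auto intro: linked_trans)
  qed
  from this[of "Suc r"] show ?thesis
    using assms(2) by (simp add: tuples_def)
qed

lemma connected_A_graph:
  assumes "k \<ge> 5"
  shows "connected (A_graph k (Suc (Suc r)))"
  unfolding connected_def
proof (rule strongly_connectedI)
  have "replicate (Suc r) 0 \<in> tuples k (Suc r)"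
    using assms by (auto simp: tuples_def)
  then show "verts (with_proj (mk_symmetric (A_graph k (Suc (Suc r))))) \<noteq> {}"
    by auto
next
  fix u v
  assume "u \<in> verts (with_proj (mk_symmetric (A_graph k (Suc (Suc r)))))"
    and "v \<in> verts (with_proj (mk_symmetric (A_graph k (Suc (Suc r)))))"
  then show "linked k r u v"
    using linked_zero_tuple[OF assms, of u r] linked_zero_tuple[OF assms, of v r]
    by (simp del: replicate_Suc) (meson linked_trans linked_sym)
qed

section \<open>The graph is antisymmetric and Eulerian\<close>

theorem theorem4p4:
  fixes n k :: nat
  assumes "n \<ge> 2" and "k \<ge> 5"
  shows "subgraph (A_graph k n) (de_bruijn k (n - 1))
    \<and> antisymmetric (A_graph k n)
    \<and> eulerian_digraph (A_graph k n)
    \<and> card (arcs (A_graph k n)) = k ^ (n - 1) * ((k - 1) div 2)"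
proof -
  obtain r where n: "n = Suc (Suc r)"
    using assms(1) by (auto simp: numeral_2_eq_2 dest: Suc_le_D)
  have "eulerian_digraph (A_graph k n)"
    using assms(2) unfolding eulerian_digraph_def n
    by (simp add: fin_digraph_A_graph connected_A_graph in_degree_A_graph out_degree_A_graph)
  with assms(2) show ?thesis
    using subgraph_A_graph[of k n] card_arcs_A_graph[of k r]
    by (simp add: n antisymmetric_A_graph)
qed

end
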